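(* Let $M=(E,\mathcal I)$ be a matroid with weights $\sigma\in\mathbb R^E_{>0}$. Assume that $M$ is $\sigma$-homogeneous. (1) For any set $H\subset E$ such that $\operatorname{cl}(H)\ne E$, we have $D_\sigma(M/H)\ge D_\sigma(M)$. (2) For any set $\emptyset\ne H\subseteq E$, we have $S_\sigma(M|H)\le S_\sigma(M)$.
   Context: The matroid $M$ is finite, loopless and of positive rank, with rank function $r$ and closure operator $\operatorname{cl}$. For $X\subseteq E$, $\sigma(X)=\sum_{e\in X}\sigma(e)$. For a matroid of positive rank with ground set $E$, rank function $r$ and weights $\sigma$, $$S_\sigma(M)=\min\Big\{\tfrac{\sigma(X)}{r(E)-r(E-X)}:X\subseteq E,\ r(E)>r(E-X)\Big\},\qquad D_\sigma(M)=\max\Big\{\tfrac{\sigma(X)}{r(X)}:X\subseteq E,\ r(X)>0\Big\}.$$ Minors carry the restricted weights. $M|H$ is the restriction of $M$ to $H$; $M/H$ is the contraction of $H$, a matroid on $E-H$ with rank function $r_{M/H}(Y)=r(H\cup Y)-r(H)$. The universal density $\eta^*_M$ is the unique minimizer of $\sum_{e}\sigma(e)^{-1}\eta(e)^2$ over the convex hull of the indicator vectors of the bases of $M$; $M$ is $\sigma$-homogeneous if $\sigma(e)^{-1}\eta^*_M(e)$ is the same for all $e\in E$ (equivalently, $S_\sigma(M)=\sigma(E)/r(E)=D_\sigma(M)$). *)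

theory Defs
  imports "HOL-Analysis.Analysis" "HOL-Library.Function_Algebras"
begin

section \<open>Pointwise real vector space structure on functions\<close>

text \<open>
  It makes \<open>hull\<close> and \<open>convex\<close> available for sets of functions \<^typ>\<open>'a \<Rightarrow> real\<close>
  over an arbitrary, possibly infinite, type \<^typ>\<open>'a\<close>.
\<close>

instantiation "fun" :: (type, real_vector) real_vector
begin

definition scaleR_fun :: "real \<Rightarrow> ('a \<Rightarrow> 'b) \<Rightarrow> 'a \<Rightarrow> 'b" where
  "scaleR_fun c f = (\<lambda>x. c *\<^sub>R f x)"

instance
  by standard (simp_all add: scaleR_fun_def plus_fun_def fun_eq_iff algebra_simps)

end

lemma scaleR_fun_apply [simp]: "(c *\<^sub>R f) x = c *\<^sub>R f x"
  by (simp add: scaleR_fun_def)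


section \<open>Matroids\<close>

datatype 'a set_system = Set_System (ground: "'a set") (indeps: "'a set set")

locale matroid =
  fixes M :: "'a set_system"
  assumes finite_ground: "finite (ground M)"
    and indep_subset_ground: "X \<in> indeps M \<Longrightarrow> X \<subseteq> ground M"
    and indep_empty: "{} \<in> indeps M"
    and indep_subset: "X \<in> indeps M \<Longrightarrow> Y \<subseteq> X \<Longrightarrow> Y \<in> indeps M"
    and augment: "X \<in> indeps M \<Longrightarrow> Y \<in> indeps M \<Longrightarrow> card X < card Y
                    \<Longrightarrow> \<exists>y\<in>Y - X. insert y X \<in> indeps M"

definition bases :: "'a set_system \<Rightarrow> 'a set set" where
  "bases M = {B \<in> indeps M. \<forall>X\<in>indeps M. B \<subseteq> X \<longrightarrow> X = B}"

definition rk :: "'a set_system \<Rightarrow> 'a set \<Rightarrow> nat" where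
  "rk M X = Max (card ` {Y \<in> indeps M. Y \<subseteq> X})"

definition cl :: "'a set_system \<Rightarrow> 'a set \<Rightarrow> 'a set" where
  "cl M X = {e \<in> ground M. rk M (insert e X) = rk M X}"

definition loopless :: "'a set_system \<Rightarrow> bool" where
  "loopless M \<longleftrightarrow> (\<forall>e\<in>ground M. {e} \<in> indeps M)"

definition restrict_to :: "'a set_system \<Rightarrow> 'a set \<Rightarrow> 'a set_system" where
  "restrict_to M H = Set_System H {X \<in> indeps M. X \<subseteq> H}"

text \<open>
  The independent sets are those whose size equals their rank \<open>r(H \<union> X) - r(H)\<close>;
  see \<open>matroid.matroid_contract\<close> and \<open>matroid.rk_contract\<close> below.
\<close>

definition contract :: "'a set_system \<Rightarrow> 'a set \<Rightarrow> 'a set_system" where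
  "contract M H = Set_System (ground M - H)
     {X. X \<subseteq> ground M - H \<and> rk M (H \<union> X) = rk M H + card X}"


section \<open>Strength, maximum density and universal density\<close>

text \<open>
  Only the values of the weight function \<open>\<sigma>\<close> on the ground set matter, so the restriction
  of \<open>\<sigma>\<close> to a minor is represented by \<open>\<sigma>\<close> itself. \<open>strength\<close> and \<open>max_density\<close> are
  meant for matroids of positive rank; otherwise they are minima and maxima of empty sets.
\<close>

definition strength :: "('a \<Rightarrow> real) \<Rightarrow> 'a set_system \<Rightarrow> real" where
  "strength \<sigma> M = Min {sum \<sigma> X / (real (rk M (ground M)) - real (rk M (ground M - X))) | X.
     X \<subseteq> ground M \<and> rk M (ground M) > rk M (ground M - X)}"

definition max_density :: "('a \<Rightarrow> real) \<Rightarrow> 'a set_system \<Rightarrow> real" where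
  "max_density \<sigma> M = Max {sum \<sigma> X / real (rk M X) | X. X \<subseteq> ground M \<and> rk M X > 0}"

text \<open>
  The elements of the base polytope vanish outside the ground set, so they correspond exactly
  to vectors indexed by the ground set.
\<close>

definition base_polytope :: "'a set_system \<Rightarrow> ('a \<Rightarrow> real) set" where
  "base_polytope M = convex hull (indicator ` bases M)"

definition energy :: "('a \<Rightarrow> real) \<Rightarrow> 'a set_system \<Rightarrow> ('a \<Rightarrow> real) \<Rightarrow> real" where
  "energy \<sigma> M \<eta> = (\<Sum>e\<in>ground M. inverse (\<sigma> e) * (\<eta> e)\<^sup>2)"

definition universal_density :: "('a \<Rightarrow> real) \<Rightarrow> 'a set_system \<Rightarrow> 'a \<Rightarrow> real" where
  "universal_density \<sigma> M = (THE \<eta>. \<eta> \<in> base_polytope M \<and>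
     (\<forall>\<zeta>\<in>base_polytope M. energy \<sigma> M \<eta> \<le> energy \<sigma> M \<zeta>))"

definition homogeneous :: "('a \<Rightarrow> real) \<Rightarrow> 'a set_system \<Rightarrow> bool" where
  "homogeneous \<sigma> M \<longleftrightarrow>
     (\<exists>c. \<forall>e\<in>ground M. inverse (\<sigma> e) * universal_density \<sigma> M e = c)"


section \<open>Minors are matroids\<close>

context matroid
begin

lemma finite_indep: "X \<in> indeps M \<Longrightarrow> finite X"
  using finite_ground finite_subset indep_subset_ground by blast

lemma finite_indeps: "finite (indeps M)"
  by (rule finite_subset[of _ "Pow (ground M)"])
     (use finite_ground indep_subset_ground in auto)

lemma card_le_rk: "Y \<in> indeps M \<Longrightarrow> Y \<subseteq> X \<Longrightarrow> card Y \<le> rk M X"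
  unfolding rk_def by (rule Max_ge) (use finite_indeps in auto)

lemma rk_attained: obtains Y where "Y \<in> indeps M" "Y \<subseteq> X" "card Y = rk M X"
proof -
  have "rk M X \<in> card ` {Y \<in> indeps M. Y \<subseteq> X}"
    unfolding rk_def by (rule Max_in) (use finite_indeps indep_empty in auto)
  then show ?thesis using that by auto
qed

lemma rk_mono: "X \<subseteq> Y \<Longrightarrow> rk M X \<le> rk M Y"
  by (metis card_le_rk order_trans rk_attained)

lemma rk_Un_le: "finite C \<Longrightarrow> rk M (A \<union> C) \<le> rk M A + card C"
proof -
  assume C: "finite C"
  obtain Y where Y: "Y \<in> indeps M" "Y \<subseteq> A \<union> C" "card Y = rk M (A \<union> C)"
    using rk_attained .
  have "card Y = card (Y \<inter> A) + card (Y - A)"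
    using finite_indep[OF Y(1)] by (metis card_Int_Diff)
  moreover have "card (Y \<inter> A) \<le> rk M A"
    by (rule card_le_rk) (use Y indep_subset in auto)
  moreover have "card (Y - A) \<le> card C"
    by (rule card_mono) (use C Y in auto)
  ultimately show ?thesis using Y by linarith
qed

lemma extend_indep:
  assumes "X \<in> indeps M" "X \<subseteq> A"
  obtains Z where "Z \<in> indeps M" "X \<subseteq> Z" "Z \<subseteq> A" "card Z = rk M A"
proof -
  have "\<exists>Z. Z \<in> indeps M \<and> X \<subseteq> Z \<and> Z \<subseteq> A \<and> card Z = rk M A"
    using assms
  proof (induction "rk M A - card X" arbitrary: X rule: less_induct)
    case less
    show ?case
    proof (cases "card X = rk M A")
      case False
      then have lt: "card X < rk M A"
        using card_le_rk[OF less.prems] by simp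
      obtain Y where Y: "Y \<in> indeps M" "Y \<subseteq> A" "card Y = rk M A"
        using rk_attained .
      obtain y where y: "y \<in> Y - X" "insert y X \<in> indeps M"
        using augment[OF less.prems(1) Y(1)] lt Y(3) by auto
      have "card (insert y X) = Suc (card X)"
        using y finite_indep[OF less.prems(1)] by simp
      then have "\<exists>Z. Z \<in> indeps M \<and> insert y X \<subseteq> Z \<and> Z \<subseteq> A \<and> card Z = rk M A"
        using y Y(2) less.prems(2) lt by (intro less.hyps) auto
      then show ?thesis by blast
    qed (use less.prems in auto)
  qed
  then show ?thesis using that by blast
qed

lemma matroid_restrict_to:
  assumes "H \<subseteq> ground M"
  shows "matroid (restrict_to M H)"
proof
  fix X Y assume "X \<in> indeps (restrict_to M H)" "Y \<in> indeps (restrict_to M H)" "card X < card Y"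
  then show "\<exists>y\<in>Y - X. insert y X \<in> indeps (restrict_to M H)"
    using augment[of X Y] by (auto simp: restrict_to_def)
qed (use assms finite_ground finite_subset indep_empty indep_subset in
      \<open>auto simp: restrict_to_def\<close>)

lemma rk_restrict_to: "Y \<subseteq> H \<Longrightarrow> rk (restrict_to M H) Y = rk M Y"
proof -
  assume "Y \<subseteq> H"
  then have "{X \<in> indeps (restrict_to M H). X \<subseteq> Y} = {X \<in> indeps M. X \<subseteq> Y}"
    by (auto simp: restrict_to_def)
  then show ?thesis by (simp add: rk_def)
qed

lemma matroid_contract: "matroid (contract M H)"
proof
  show "finite (ground (contract M H))"
    using finite_ground by (simp add: contract_def)
  show "X \<subseteq> ground (contract M H)" if "X \<in> indeps (contract M H)" for X
    using that by (simp add: contract_def)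
  show "{} \<in> indeps (contract M H)"
    by (simp add: contract_def)
next
  fix X Y assume X: "X \<in> indeps (contract M H)" and YX: "Y \<subseteq> X"
  have fin: "finite X" "finite Y" "X \<subseteq> ground M - H"
    using X YX finite_ground by (auto simp: contract_def intro: finite_subset)
  have "rk M (H \<union> X) \<le> rk M (H \<union> Y) + card (X - Y)"
    using rk_Un_le[of "X - Y" "H \<union> Y"] fin YX by (simp add: Un_assoc Un_absorb1)
  moreover have "rk M (H \<union> Y) \<le> rk M H + card Y"
    by (rule rk_Un_le) (rule fin)
  moreover have "card X = card Y + card (X - Y)"
    using YX fin by (simp add: card_Diff_subset card_mono)
  moreover have "rk M (H \<union> X) = rk M H + card X"
    using X by (simp add: contract_def)
  ultimately show "Y \<in> indeps (contract M H)"
    using YX fin by (auto simp: contract_def)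
next
  fix X Y
  assume X: "X \<in> indeps (contract M H)" and Y: "Y \<in> indeps (contract M H)"
    and lt: "card X < card Y"
  have X': "X \<subseteq> ground M - H" "rk M (H \<union> X) = rk M H + card X" "finite X"
    and Y': "Y \<subseteq> ground M - H" "rk M (H \<union> Y) = rk M H + card Y"
    using X Y finite_ground by (auto simp: contract_def intro: finite_subset)
  obtain A where A: "A \<in> indeps M" "A \<subseteq> H \<union> X" "card A = rk M (H \<union> X)"
    using rk_attained .
  obtain B where B: "B \<in> indeps M" "B \<subseteq> H \<union> Y" "card B = rk M (H \<union> Y)"
    using rk_attained .
  obtain y where y: "y \<in> B - A" "insert y A \<in> indeps M"
    using augment[OF A(1) B(1)] A B X' Y' lt by auto
  have cA: "card (insert y A) = Suc (card A)"
    using y finite_indep[OF A(1)] by simp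
  have "y \<notin> H \<union> X"
    using card_le_rk[OF y(2), of "H \<union> X"] A cA by auto
  then have yY: "y \<in> Y - X" using y B by auto
  have "rk M H + card (insert y X) \<le> rk M (H \<union> insert y X)"
    using card_le_rk[OF y(2), of "H \<union> insert y X"] A cA X' yY by auto
  moreover have "rk M (H \<union> insert y X) \<le> rk M H + card (insert y X)"
    by (rule rk_Un_le) (use X' in simp)
  ultimately have "insert y X \<in> indeps (contract M H)"
    using yY X' Y' by (auto simp: contract_def)
  then show "\<exists>y\<in>Y - X. insert y X \<in> indeps (contract M H)"
    using yY by blast
qed

lemma rk_contract:
  assumes "Y \<subseteq> ground M - H"
  shows "rk (contract M H) Y = rk M (H \<union> Y) - rk M H"
proof (rule antisym)
  interpret C: matroid "contract M H" by (rule matroid_contract)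
  obtain X where X: "X \<in> indeps (contract M H)" "X \<subseteq> Y" "card X = rk (contract M H) Y"
    using C.rk_attained .
  have "rk M (H \<union> X) \<le> rk M (H \<union> Y)"
    by (rule rk_mono) (use X in auto)
  then show "rk (contract M H) Y \<le> rk M (H \<union> Y) - rk M H"
    using X by (simp add: contract_def)
  obtain A where A: "A \<in> indeps M" "A \<subseteq> H" "card A = rk M H"
    using rk_attained .
  obtain B where B: "B \<in> indeps M" "A \<subseteq> B" "B \<subseteq> H \<union> Y" "card B = rk M (H \<union> Y)"
    using extend_indep[OF A(1), of "H \<union> Y"] A by blast
  have fin: "finite B" using finite_indep B by blast
  have "card (B \<inter> H) = rk M H"
    using card_le_rk[of "B \<inter> H" H] card_mono[of "B \<inter> H" A] A B fin
      indep_subset[OF B(1), of "B \<inter> H"] by auto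
  then have card: "card (B - H) + rk M H = card B"
    using fin card_Int_Diff[of B H] by simp
  have "card B \<le> rk M (H \<union> (B - H))"
    by (rule card_le_rk) (use B in auto)
  moreover have "rk M (H \<union> (B - H)) \<le> rk M H + card (B - H)"
    by (rule rk_Un_le) (use fin in simp)
  ultimately have "B - H \<in> indeps (contract M H)"
    using card B assms by (auto simp: contract_def)
  then have "card (B - H) \<le> rk (contract M H) Y"
    by (rule C.card_le_rk) (use B in auto)
  then show "rk M (H \<union> Y) - rk M H \<le> rk (contract M H) Y"
    using card B by simp
qed


section \<open>The universal density is well defined\<close>

lemma bases_nonempty: "bases M \<noteq> {}"
proof -
  obtain B where B: "B \<in> indeps M" "B \<subseteq> ground M" "card B = rk M (ground M)"
    using rk_attained .
  have "X = B" if "X \<in> indeps M" "B \<subseteq> X" for X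
    using card_le_rk[of X "ground M"] card_seteq[of X B] that B finite_indep
      indep_subset_ground by auto
  then have "B \<in> bases M" using B by (auto simp: bases_def)
  then show ?thesis by blast
qed

end

lemma compact_convex_hull_fun:
  fixes S :: "('a \<Rightarrow> real) set"
  assumes "finite S"
  shows "compact (convex hull S)"
  using assms
proof (induction S rule: finite_induct)
  case (insert a S)
  show ?case
  proof (cases "S = {}")
    case False
    have "convex hull (insert a S)
        = (\<lambda>(u, x). (1 - u) *\<^sub>R a + u *\<^sub>R x) ` ({0..1} \<times> (convex hull S))" (is "_ = ?f ` ?T")
    proof (rule set_eqI)
      fix z
      have "z \<in> convex hull (insert a S) \<longleftrightarrow> (\<exists>u v b. 0 \<le> u \<and> 0 \<le> v \<and> u + v = 1 \<and>
          b \<in> convex hull S \<and> z = u *\<^sub>R a + v *\<^sub>R b)"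
        using convex_hull_insert[OF False, of a] by auto
      also have "\<dots> \<longleftrightarrow> (\<exists>u b. 0 \<le> u \<and> u \<le> 1 \<and> b \<in> convex hull S \<and> z = (1 - u) *\<^sub>R a + u *\<^sub>R b)"
        (is "?L \<longleftrightarrow> ?R")
      proof
        assume ?L
        then obtain u v b where "0 \<le> u" "0 \<le> v" "u + v = 1" "b \<in> convex hull S"
            "z = u *\<^sub>R a + v *\<^sub>R b" by blast
        moreover from this have "u = 1 - v" by simp
        ultimately show ?R by (intro exI[of _ v] exI[of _ b]) auto
      next
        assume ?R
        then obtain u b where "0 \<le> u" "u \<le> 1" "b \<in> convex hull S"
            "z = (1 - u) *\<^sub>R a + u *\<^sub>R b" by blast
        then show ?L by (intro exI[of _ "1 - u"] exI[of _ u] exI[of _ b]) auto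
      qed
      also have "\<dots> \<longleftrightarrow> z \<in> ?f ` ?T" by (auto simp: image_iff)
      finally show "z \<in> convex hull (insert a S) \<longleftrightarrow> z \<in> ?f ` ?T" .
    qed
    moreover have "continuous_on ?T ?f"
    proof (rule continuous_on_coordinatewise_then_product)
      fix i
      have "continuous_on ?T (\<lambda>p. snd p i)"
        by (rule continuous_on_product_then_coordinatewise) (intro continuous_intros)
      then show "continuous_on ?T (\<lambda>p. ?f p i)"
        by (auto simp: case_prod_unfold intro!: continuous_intros)
    qed
    moreover have "compact ?T"
      by (intro compact_Times insert.IH) auto
    ultimately show ?thesis
      by (simp only: compact_continuous_image)
  qed simp
qed simp

lemma base_polytope_outside:
  assumes "matroid M" "\<eta> \<in> base_polytope M" "e \<notin> ground M"
  shows "\<eta> e = 0"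
proof -
  interpret matroid M by fact
  have "base_polytope M \<subseteq> {\<eta>. \<eta> e = 0}"
    unfolding base_polytope_def
  proof (rule hull_minimal)
    show "indicator ` bases M \<subseteq> {\<eta> :: 'a \<Rightarrow> real. \<eta> e = 0}"
      using assms(3) by (auto simp: bases_def indicator_def dest!: indep_subset_ground)
    show "convex {\<eta> :: 'a \<Rightarrow> real. \<eta> e = 0}"
      by (auto simp: convex_def)
  qed
  then show ?thesis using assms by auto
qed

lemma universal_density_ex1:
  assumes "matroid M" and pos: "\<forall>e\<in>ground M. \<sigma> e > 0"
  shows "\<exists>!\<eta>. \<eta> \<in> base_polytope M \<and> (\<forall>\<zeta>\<in>base_polytope M. energy \<sigma> M \<eta> \<le> energy \<sigma> M \<zeta>)"
proof -
  interpret matroid M by fact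
  have "finite (bases M)"
    using finite_indeps by (auto simp: bases_def)
  then have "compact (base_polytope M)"
    unfolding base_polytope_def by (intro compact_convex_hull_fun) auto
  moreover have "base_polytope M \<noteq> {}"
    using bases_nonempty by (simp add: base_polytope_def)
  moreover have "continuous_on (base_polytope M) (energy \<sigma> M)"
    unfolding energy_def
    by (intro continuous_intros continuous_on_product_then_coordinatewise continuous_on_id)
  ultimately have ex: "\<exists>\<eta>\<in>base_polytope M. \<forall>\<zeta>\<in>base_polytope M. energy \<sigma> M \<eta> \<le> energy \<sigma> M \<zeta>"
    by (rule continuous_attains_inf)
  moreover have "x = y"
    if x: "x \<in> base_polytope M" "\<forall>\<zeta>\<in>base_polytope M. energy \<sigma> M x \<le> energy \<sigma> M \<zeta>"
      and y: "y \<in> base_polytope M" "\<forall>\<zeta>\<in>base_polytope M. energy \<sigma> M y \<le> energy \<sigma> M \<zeta>" for x y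
  proof
    fix e
    let ?m = "(1/2) *\<^sub>R x + (1/2) *\<^sub>R y"
    have "convex (base_polytope M)" by (simp add: base_polytope_def)
    then have m: "?m \<in> base_polytope M"
      using x(1) y(1) by (intro convexD) auto
    let ?d = "\<Sum>e\<in>ground M. inverse (\<sigma> e) * (x e - y e)\<^sup>2"
    have "4 * energy \<sigma> M ?m + ?d = 2 * energy \<sigma> M x + 2 * energy \<sigma> M y"
      unfolding energy_def sum_distrib_left sum.distrib[symmetric]
      by (rule sum.cong) (simp_all add: power2_eq_square algebra_simps)
    moreover have "energy \<sigma> M x \<le> energy \<sigma> M ?m" "energy \<sigma> M y \<le> energy \<sigma> M ?m"
      using x y m by auto
    ultimately have "?d \<le> 0" by linarith
    moreover have nn: "inverse (\<sigma> e) * (x e - y e)\<^sup>2 \<ge> 0" if "e \<in> ground M" for e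
      using pos that by (simp add: less_imp_le)
    ultimately have "?d = 0" by (metis (no_types, lifting) antisym sum_nonneg)
    then have "\<forall>e\<in>ground M. inverse (\<sigma> e) * (x e - y e)\<^sup>2 = 0"
      using nn finite_ground by (subst (asm) sum_nonneg_eq_0_iff) auto
    then have "\<forall>e\<in>ground M. x e = y e"
      using pos by fastforce
    then show "x e = y e"
      using base_polytope_outside[OF assms(1) x(1)] base_polytope_outside[OF assms(1) y(1)]
      by (cases "e \<in> ground M") auto
  qed
  ultimately show ?thesis by blast
qed

end

theory Submission
  imports Defs
begin

text \<open>
  Homogeneity says that the universal density, a point of the base polytope, is a multiple
  \<open>c\<sigma>\<close> of the weights. Every point \<open>\<eta>\<close> of the base polytope satisfies \<open>\<eta>(X) \<le> r(X)\<close> for all \<open>X\<close>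
  and \<open>\<eta>(E) = r(E)\<close>, because the indicators of bases do and these conditions are convex. Hence
  \<open>c\<sigma>(X) \<le> r(X)\<close> for all \<open>X\<close>, with equality for \<open>X = E\<close>, so \<open>c > 0\<close>. Complementation turns this
  into \<open>c\<sigma>(X) \<ge> r(E) - r(E - X)\<close>. Both inequalities are in \<open>homogeneous_scaling\<close>.

  The number \<open>1/c\<close> separates the two sides of each claim. The inequalities bound every quotient
  in \<open>D\<^sub>\<sigma>(M)\<close> by \<open>1/c\<close> from above and every quotient in \<open>S\<^sub>\<sigma>(M)\<close> by \<open>1/c\<close> from below. In the minors
  it suffices to look at the quotient of the whole ground set, where the roles of the two
  inequalities are exchanged: \<open>\<sigma>(E - H) / (r(E) - r(H)) \<ge> 1/c\<close> for \<open>M/H\<close>, by the second one, and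
  \<open>\<sigma>(H) / r(H) \<le> 1/c\<close> for \<open>M|H\<close>, by the first one.
\<close>

context matroid
begin

lemma rk_empty [simp]: "rk M {} = 0"
  by (metis card.empty rk_attained subset_empty)

lemma card_basis:
  assumes "B \<in> bases M"
  shows "card B = rk M (ground M)"
proof -
  have B: "B \<in> indeps M" using assms by (simp add: bases_def)
  obtain Z where "Z \<in> indeps M" "B \<subseteq> Z" "card Z = rk M (ground M)"
    using extend_indep[OF B indep_subset_ground[OF B]] by blast
  then show ?thesis using assms by (auto simp: bases_def)
qed

lemma sum_indicator_eq_card:
  assumes "X \<subseteq> ground M"
  shows "sum (indicator B) X = real (card (X \<inter> B))"
  using finite_subset[OF assms finite_ground]
  by (simp add: indicator_def sum.If_cases Int_def)

lemma base_polytope_sum_le_rk: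
  assumes "\<eta> \<in> base_polytope M" and X: "X \<subseteq> ground M"
  shows "sum \<eta> X \<le> rk M X"
proof -
  have "base_polytope M \<subseteq> {\<eta> :: 'a \<Rightarrow> real. sum \<eta> X \<le> rk M X}"
    unfolding base_polytope_def
  proof (rule hull_minimal)
    have "card (X \<inter> B) \<le> rk M X" if "B \<in> bases M" for B
      using that indep_subset[of B "X \<inter> B"] by (intro card_le_rk) (auto simp: bases_def)
    then show "indicator ` bases M \<subseteq> {\<eta> :: 'a \<Rightarrow> real. sum \<eta> X \<le> rk M X}"
      by (auto simp: sum_indicator_eq_card[OF X])
    show "convex {\<eta> :: 'a \<Rightarrow> real. sum \<eta> X \<le> rk M X}"
      by (auto simp: convex_def sum.distrib sum_distrib_left[symmetric]
          intro: convex_bound_le)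
  qed
  then show ?thesis using assms by auto
qed

lemma base_polytope_sum_ground:
  assumes "\<eta> \<in> base_polytope M"
  shows "sum \<eta> (ground M) = rk M (ground M)"
proof -
  have "base_polytope M \<subseteq> {\<eta> :: 'a \<Rightarrow> real. sum \<eta> (ground M) = rk M (ground M)}"
    unfolding base_polytope_def
  proof (rule hull_minimal)
    have "ground M \<inter> B = B" if "B \<in> bases M" for B
      using that indep_subset_ground by (auto simp: bases_def)
    then show "indicator ` bases M \<subseteq> {\<eta> :: 'a \<Rightarrow> real. sum \<eta> (ground M) = rk M (ground M)}"
      by (auto simp: sum_indicator_eq_card card_basis)
    show "convex {\<eta> :: 'a \<Rightarrow> real. sum \<eta> (ground M) = rk M (ground M)}"
      by (auto simp: convex_def sum.distrib sum_distrib_left[symmetric] simp flip: distrib_right)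
  qed
  then show ?thesis using assms by auto
qed

lemma rk_less_if_cl_ne_ground:
  assumes "H \<subseteq> ground M" "cl M H \<noteq> ground M"
  shows "rk M H < rk M (ground M)"
proof -
  obtain e where e: "e \<in> ground M" "rk M (insert e H) \<noteq> rk M H"
    using assms(2) by (auto simp: cl_def)
  have "rk M H \<le> rk M (insert e H)" "rk M (insert e H) \<le> rk M (ground M)"
    using e assms(1) by (auto intro: rk_mono)
  then show ?thesis using e by simp
qed

lemma rk_pos_if_loopless:
  assumes "loopless M" "H \<subseteq> ground M" "H \<noteq> {}"
  shows "rk M H > 0"
proof -
  obtain e where "e \<in> H" using assms by blast
  then show ?thesis using card_le_rk[of "{e}" H] assms by (auto simp: loopless_def)
qed

lemma finite_ground_subsets_image: "finite {f X | X. X \<subseteq> ground M \<and> P X}"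
  using finite_ground by (intro finite_image_set) (auto intro: finite_subset[of _ "Pow (ground M)"])

lemma max_density_ground_ge:
  assumes "rk M (ground M) > 0"
  shows "sum \<sigma> (ground M) / rk M (ground M) \<le> max_density \<sigma> M"
  unfolding max_density_def using assms
  by (intro Max_ge finite_ground_subsets_image) auto

lemma max_density_leI:
  assumes "rk M (ground M) > 0"
    and "\<And>X. X \<subseteq> ground M \<Longrightarrow> rk M X > 0 \<Longrightarrow> sum \<sigma> X / rk M X \<le> d"
  shows "max_density \<sigma> M \<le> d"
  unfolding max_density_def using assms
  by (subst Max_le_iff[OF finite_ground_subsets_image]) auto

lemma strength_ground_le:
  assumes "rk M (ground M) > 0"
  shows "strength \<sigma> M \<le> sum \<sigma> (ground M) / rk M (ground M)"
  unfolding strength_def using assms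
  by (intro Min_le finite_ground_subsets_image) (auto intro!: exI[of _ "ground M"])

lemma strength_geI:
  assumes "rk M (ground M) > 0"
    and "\<And>X. X \<subseteq> ground M \<Longrightarrow> rk M (ground M - X) < rk M (ground M) \<Longrightarrow>
           s \<le> sum \<sigma> X / (real (rk M (ground M)) - real (rk M (ground M - X)))"
  shows "s \<le> strength \<sigma> M"
  unfolding strength_def using assms
  by (subst Min_ge_iff[OF finite_ground_subsets_image]) (auto intro!: exI[of _ "ground M"])

text \<open>
  If \<open>c\<sigma>\<close> is the universal density, the first inequality is the rank bound of the base polytope.
  The second one is the first for \<open>E - X\<close>, subtracted from the equality \<open>c\<sigma>(E) = r(E)\<close>, which
  also gives \<open>c > 0\<close>.
\<close>

lemma homogeneous_scaling:
  assumes pos: "\<forall>e\<in>ground M. \<sigma> e > 0" and rk: "rk M (ground M) > 0"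
    and hom: "homogeneous \<sigma> M"
  obtains c where "c > 0"
    and "\<And>X. X \<subseteq> ground M \<Longrightarrow> c * sum \<sigma> X \<le> rk M X"
    and "\<And>X. X \<subseteq> ground M \<Longrightarrow> real (rk M (ground M)) - real (rk M (ground M - X)) \<le> c * sum \<sigma> X"
proof -
  let ?\<eta> = "universal_density \<sigma> M"
  have \<eta>: "?\<eta> \<in> base_polytope M"
    using theI'[OF universal_density_ex1[OF matroid_axioms pos]]
    by (simp add: universal_density_def)
  obtain c where c: "\<And>e. e \<in> ground M \<Longrightarrow> inverse (\<sigma> e) * ?\<eta> e = c"
    using hom by (auto simp: homogeneous_def)
  have "?\<eta> e = c * \<sigma> e" if "e \<in> ground M" for e
    using c[OF that] pos that by (fastforce simp: field_simps)
  then have scale: "sum ?\<eta> X = c * sum \<sigma> X" if "X \<subseteq> ground M" for X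
    using that unfolding sum_distrib_left by (intro sum.cong) auto
  have upper: "c * sum \<sigma> X \<le> rk M X" if "X \<subseteq> ground M" for X
    using base_polytope_sum_le_rk[OF \<eta> that] scale[OF that] by simp
  have total: "c * sum \<sigma> (ground M) = rk M (ground M)"
    using base_polytope_sum_ground[OF \<eta>] scale by simp
  have "sum \<sigma> (ground M) \<ge> 0"
    using pos by (auto intro: sum_nonneg less_imp_le)
  moreover have "c * sum \<sigma> (ground M) > 0"
    using total rk by simp
  ultimately have "c > 0"
    by (simp add: zero_less_mult_iff)
  moreover have "real (rk M (ground M)) - real (rk M (ground M - X)) \<le> c * sum \<sigma> X"
    if X: "X \<subseteq> ground M" for X
    using upper[of "ground M - X"] total sum_diff[OF finite_ground X, of \<sigma>]
    by (simp add: right_diff_distrib)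
  ultimately show ?thesis using that upper by blast
qed

end

theorem lemma6p2:
  fixes M :: "'a set_system" and \<sigma> :: "'a \<Rightarrow> real"
  assumes "matroid M"
    and "loopless M"
    and "rk M (ground M) > 0"
    and "\<forall>e\<in>ground M. \<sigma> e > 0"
    and "homogeneous \<sigma> M"
  shows "(\<forall>H. H \<subseteq> ground M \<and> cl M H \<noteq> ground M \<longrightarrow>
            max_density \<sigma> (contract M H) \<ge> max_density \<sigma> M) \<and>
         (\<forall>H. H \<noteq> {} \<and> H \<subseteq> ground M \<longrightarrow>
            strength \<sigma> (restrict_to M H) \<le> strength \<sigma> M)"
proof -
  interpret matroid M by fact
  obtain c where c: "c > 0"
    and upper: "\<And>X. X \<subseteq> ground M \<Longrightarrow> c * sum \<sigma> X \<le> rk M X"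
    and lower: "\<And>X. X \<subseteq> ground M \<Longrightarrow>
      real (rk M (ground M)) - real (rk M (ground M - X)) \<le> c * sum \<sigma> X"
    using homogeneous_scaling assms(3-5) by blast
  have D: "max_density \<sigma> M \<le> 1 / c"
    using upper c by (intro max_density_leI assms) (simp add: field_simps)
  have S: "1 / c \<le> strength \<sigma> M"
    using lower c by (intro strength_geI assms) (simp add: field_simps)
  have "max_density \<sigma> M \<le> max_density \<sigma> (contract M H)"
    if H: "H \<subseteq> ground M" "cl M H \<noteq> ground M" for H
  proof -
    interpret C: matroid "contract M H" by (rule matroid_contract)
    have ground: "ground (contract M H) = ground M - H"
      by (simp add: contract_def)
    have less: "rk M H < rk M (ground M)"
      using H by (rule rk_less_if_cl_ne_ground)
    have rk: "rk (contract M H) (ground M - H) = rk M (ground M) - rk M H"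
      using H by (simp add: rk_contract Un_absorb1)
    have "real (rk M (ground M)) - real (rk M H) \<le> c * sum \<sigma> (ground M - H)"
      using lower[of "ground M - H"] H by (simp add: double_diff)
    then have "1 / c \<le> sum \<sigma> (ground M - H) / (real (rk M (ground M)) - real (rk M H))"
      using c less by (simp add: field_simps)
    also have "\<dots> \<le> max_density \<sigma> (contract M H)"
      using C.max_density_ground_ge[of \<sigma>] less by (simp add: ground rk of_nat_diff)
    finally show ?thesis using D by linarith
  qed
  moreover have "strength \<sigma> (restrict_to M H) \<le> strength \<sigma> M"
    if H: "H \<noteq> {}" "H \<subseteq> ground M" for H
  proof -
    interpret R: matroid "restrict_to M H" using H(2) by (rule matroid_restrict_to)
    have ground: "ground (restrict_to M H) = H"
      by (simp add: restrict_to_def)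
    have pos: "rk M H > 0"
      using assms(2) H by (intro rk_pos_if_loopless)
    have "strength \<sigma> (restrict_to M H) \<le> sum \<sigma> H / rk M H"
      using R.strength_ground_le[of \<sigma>] pos by (simp add: ground rk_restrict_to)
    also have "\<dots> \<le> 1 / c"
      using upper[OF H(2)] pos c by (simp add: field_simps)
    finally show ?thesis using S by linarith
  qed
  ultimately show ?thesis by blast
qed

end
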